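(* Let $q\ge5$ be a prime power. No $\Gamma$-plane, $0_{\mathcal C}$-plane, $2_{\mathcal C}$-plane or $3_{\mathcal C}$-plane contains an imaginary chord of $\mathcal C$. All $q+1$ planes through an imaginary chord are $\overline{1_{\mathcal C}}$-planes (forming a pencil), and every $\overline{1_{\mathcal C}}$-plane contains exactly one imaginary chord. Consequently, the set of all $\overline{1_{\mathcal C}}$-planes, which has size $\binom{q}{2}(q+1)$, is partitioned into $\binom{q}{2}$ pencils of planes, each having an imaginary chord as axis.
   Context: Let $\mathrm{PG}(3,q)$ have points $\mathbf{P}(x_0,x_1,x_2,x_3)$; put $P(t)=\mathbf{P}(t^3,t^2,t,1)$ ($t\in\mathbb{F}_q$), $P(\infty)=\mathbf{P}(1,0,0,0)$, and let $\mathcal{C}=\{P(t):t\in\mathbb{F}_q\cup\{\infty\}\}$ be the twisted cubic. Write $\boldsymbol{\pi}(c_0,c_1,c_2,c_3)$ for the plane $c_0x_0+c_1x_1+c_2x_2+c_3x_3=0$. The osculating plane at $P(t)$ is $\boldsymbol{\pi}(1,-3t,3t^2,-t^3)$ ($t\in\mathbb{F}_q$) and $\boldsymbol{\pi}(0,0,0,1)$ ($t=\infty$); these are the $\Gamma$-planes. A $d_{\mathcal C}$-plane ($d\in\{0,2,3\}$) contains exactly $d$ points of $\mathcal C$; a $\overline{1_{\mathcal C}}$-plane is a plane that is not a $\Gamma$-plane and contains exactly one point of $\mathcal C$. An imaginary chord is the line of $\mathrm{PG}(3,q)$ joining the conjugate points $P(s)$ and $P(s^q)$ for $s\in\mathbb{F}_{q^2}\setminus\mathbb{F}_q$;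 there are $\binom q2$ imaginary chords. *)

theory Defs
  imports "HOL-Analysis.Cartesian_Space" "HOL-Library.Disjoint_Sets"
begin

text \<open>
  The points, lines and planes of PG(3,q) are the linear subspaces of \<^typ>\<open>'a ^ 4\<close> of
  dimension 1, 2 and 3, where \<^typ>\<open>'a\<close> is the field with q elements; incidence is inclusion.
  The elements of the index type \<^typ>\<open>4\<close> are 0, 1, 2, 3 (with 4 = 0), so the components
  of a vector are numbered as the homogeneous coordinates \<open>x\<^sub>0, \<dots>, x\<^sub>3\<close>.
\<close>

definition pg_lines :: "('a::field ^ 4) set set" where
  "pg_lines = {L. vec.subspace L \<and> vec.dim L = 2}"

definition pg_planes :: "('a::field ^ 4) set set" where
  "pg_planes = {H. vec.subspace H \<and> vec.dim H = 3}"

definition coords :: "'a \<Rightarrow> 'a \<Rightarrow> 'a \<Rightarrow> 'a \<Rightarrow> 'a ^ 4" where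
  "coords a b c d = (\<chi> i. if i = 0 then a else if i = 1 then b else if i = 2 then c else d)"

definition pg_point :: "'a::field ^ 4 \<Rightarrow> ('a ^ 4) set" where
  "pg_point x = vec.span {x}"

definition plane_of :: "'a::field \<Rightarrow> 'a \<Rightarrow> 'a \<Rightarrow> 'a \<Rightarrow> ('a ^ 4) set" where
  "plane_of c0 c1 c2 c3 = {x. c0 * x $ 0 + c1 * x $ 1 + c2 * x $ 2 + c3 * x $ 3 = 0}"

text \<open>The parameter \<^term>\<open>None\<close> plays the role of \<open>\<infinity>\<close>.\<close>

fun cubic_vec :: "'a::field option \<Rightarrow> 'a ^ 4" where
  "cubic_vec (Some t) = coords (t ^ 3) (t ^ 2) t 1"
| "cubic_vec None = coords 1 0 0 0"

definition twisted_cubic :: "('a::field ^ 4) set set" where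
  "twisted_cubic = range (\<lambda>t. pg_point (cubic_vec t))"

fun osculating_plane :: "'a::field option \<Rightarrow> ('a ^ 4) set" where
  "osculating_plane (Some t) = plane_of 1 (- 3 * t) (3 * t ^ 2) (- (t ^ 3))"
| "osculating_plane None = plane_of 0 0 0 1"

definition Gamma_planes :: "('a::field ^ 4) set set" where
  "Gamma_planes = range osculating_plane"

definition cubic_points_on :: "('a::field ^ 4) set \<Rightarrow> ('a ^ 4) set set" where
  "cubic_points_on H = {P \<in> twisted_cubic. P \<subseteq> H}"

definition secant_planes :: "nat \<Rightarrow> ('a::{field,finite} ^ 4) set set" where
  "secant_planes d = {H \<in> pg_planes. card (cubic_points_on H) = d}"

definition one_bar_planes :: "('a::{field,finite} ^ 4) set set" where
  "one_bar_planes = {H \<in> pg_planes. H \<notin> Gamma_planes \<and> card (cubic_points_on H) = 1}"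

definition field_embedding :: "('a::field \<Rightarrow> 'b::field) \<Rightarrow> bool" where
  "field_embedding h \<longleftrightarrow>
     h 1 = 1 \<and> (\<forall>x y. h (x + y) = h x + h y) \<and> (\<forall>x y. h (x * y) = h x * h y)"

text \<open>
  For an embedding \<open>h\<close> of \<open>F\<^sub>q\<close> into \<open>F\<close> with \<open>q\<^sup>2\<close> elements, the line of PG(3,q) joining
  the conjugate points \<open>P(s)\<close> and \<open>P(s\<^sup>q)\<close> consists of the points of PG(3,q)
  that lie on the line of \<open>PG(3,q\<^sup>2)\<close> through \<open>P(s)\<close> and \<open>P(s\<^sup>q)\<close>.
\<close>

definition imaginary_chord ::
  "('a::{field,finite} \<Rightarrow> 'b::field) \<Rightarrow> 'b \<Rightarrow> ('a ^ 4) set" where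
  "imaginary_chord h s =
     {x. (\<chi> i. h (x $ i)) \<in> vec.span {cubic_vec (Some s), cubic_vec (Some (s ^ CARD('a)))}}"

definition imaginary_chords ::
  "('a::{field,finite} \<Rightarrow> 'b::field) \<Rightarrow> ('a ^ 4) set set" where
  "imaginary_chords h = imaginary_chord h ` (- range h)"

definition planes_through :: "('a::field ^ 4) set \<Rightarrow> ('a ^ 4) set set" where
  "planes_through L = {H \<in> pg_planes. L \<subseteq> H}"

text \<open>A pencil of planes consists of all planes through a line, called its axis.\<close>

definition pencil_with_axis :: "('a::field ^ 4) set set \<Rightarrow> ('a ^ 4) set \<Rightarrow> bool" where
  "pencil_with_axis S L \<longleftrightarrow> L \<in> pg_lines \<and> S = planes_through L"

end

theory Submission
  imports Defs "HOL-Computational_Algebra.Polynomial"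
begin

text \<open>
  A plane \<open>\<pi>(c\<^sub>0, c\<^sub>1, c\<^sub>2, c\<^sub>3)\<close> corresponds to the binary cubic form
  \<open>f(t) = c\<^sub>0 t\<^sup>3 + c\<^sub>1 t\<^sup>2 + c\<^sub>2 t + c\<^sub>3\<close>, whose zeros on the projective line (\<open>\<infinity>\<close> being
  a zero when \<open>c\<^sub>0 = 0\<close>) are the points of the cubic on the plane; the osculating planes are the
  cubes of linear forms. If \<open>s\<close> has trace \<open>T\<close> and norm \<open>N\<close> over \<open>F\<^sub>q\<close>, then a plane contains the
  imaginary chord of \<open>s\<close> if and only if \<open>t\<^sup>2 - T t + N\<close> divides \<open>f\<close>, and the planes through the
  chord are parametrised by the zero of the remaining linear factor. Conversely, a form that has
  exactly one zero and is not a cube is a linear factor times an irreducible quadratic. There are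
  \<open>q choose 2\<close> irreducible monic quadratics, and as many are minimal polynomials of
  elements of \<open>F\<close>, so each of them splits in \<open>F\<close> and comes from exactly one chord.
\<close>

subsection \<open>Planes and the twisted cubic\<close>


lemma coords_nth [simp]:
  "coords a b c d $ 0 = a" "coords a b c d $ 1 = b"
  "coords a b c d $ 2 = c" "coords a b c d $ 3 = d"
  by (simp_all add: coords_def)

text \<open>\<open>sum_4\<close> and \<open>forall_4\<close> enumerate the indices as 1, 2, 3, 4;
  the last of them is the coordinate \<open>x $ 0\<close>.\<close>

lemma four_eq_zero: "(4::4) = 0"
  by simp

lemma sum_UNIV_4: "(\<Sum>i\<in>UNIV. f i) = f 0 + f 1 + f 2 + f (3::4)"
  by (simp add: sum_4 four_eq_zero ac_simps)

lemma vec4_eq_iff: "x = y \<longleftrightarrow> x $ 0 = y $ 0 \<and> x $ 1 = y $ 1 \<and> x $ 2 = y $ 2 \<and> x $ 3 = y $ 3"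
  for x y :: "'a ^ 4"
  unfolding vec_eq_iff forall_4 four_eq_zero by auto

lemma in_plane_of: "x \<in> plane_of c0 c1 c2 c3 \<longleftrightarrow> c0 * x $ 0 + c1 * x $ 1 + c2 * x $ 2 + c3 * x $ 3 = 0"
  by (simp add: plane_of_def)

lemma subspace_plane_of: "vec.subspace (plane_of c0 c1 c2 c3)"
proof (rule vec.subspaceI)
  show "k *s x \<in> plane_of c0 c1 c2 c3" if "x \<in> plane_of c0 c1 c2 c3" for k x
  proof -
    have "c0 * (k * x $ 0) + c1 * (k * x $ 1) + c2 * (k * x $ 2) + c3 * (k * x $ 3)
      = k * (c0 * x $ 0 + c1 * x $ 1 + c2 * x $ 2 + c3 * x $ 3)"
      by (simp add: algebra_simps)
    then show ?thesis using that by (simp add: in_plane_of)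
  qed
  show "x + y \<in> plane_of c0 c1 c2 c3"
    if "x \<in> plane_of c0 c1 c2 c3" "y \<in> plane_of c0 c1 c2 c3" for x y
  proof -
    have "c0 * (x+y) $ 0 + c1 * (x+y) $ 1 + c2 * (x+y) $ 2 + c3 * (x+y) $ 3
      = (c0 * x $ 0 + c1 * x $ 1 + c2 * x $ 2 + c3 * x $ 3) + (c0 * y $ 0 + c1 * y $ 1 + c2 * y $ 2 + c3 * y $ 3)"
      by (simp add: algebra_simps)
    then show ?thesis using that by (simp only: in_plane_of) simp
  qed
qed (simp add: in_plane_of)

text \<open>One vector \<open>e\<close> off the plane completes it to the whole space: subtracting a
  multiple of \<open>e\<close> moves any vector into the kernel of the form.\<close>

lemma dim_plane_of:
  assumes "(c0, c1, c2, c3) \<noteq> (0, 0, 0, 0)"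
  shows "vec.dim (plane_of c0 c1 c2 c3) = 3"
proof -
  let ?H = "plane_of c0 c1 c2 c3"
  define l where "l x = c0 * x $ 0 + c1 * x $ 1 + c2 * x $ 2 + c3 * x $ 3" for x :: "'a ^ 4"
  have "\<exists>e. l e \<noteq> 0"
  proof (rule ccontr)
    assume "\<nexists>e. l e \<noteq> 0"
    then have "l (coords 1 0 0 0) = 0 \<and> l (coords 0 1 0 0) = 0 \<and> l (coords 0 0 1 0) = 0 \<and> l (coords 0 0 0 1) = 0"
      by blast
    with assms show False by (simp add: l_def)
  qed
  then obtain e where e: "l e \<noteq> 0" by blast
  have H: "x \<in> ?H \<longleftrightarrow> l x = 0" for x by (simp add: in_plane_of l_def)
  have sp: "vec.span ?H = ?H" using subspace_plane_of vec.span_eq_iff by blast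
  have "x - (l x / l e) *s e \<in> ?H" for x
  proof -
    have "l (x - k *s e) = l x - k * l e" for k by (simp add: l_def algebra_simps)
    then show ?thesis using e by (simp add: H)
  qed
  then have "vec.span (insert e ?H) = UNIV"
    unfolding vec.span_insert sp by auto
  then have "4 = vec.dim (insert e ?H)"
    using vec.dim_span[of "insert e ?H"] vec_dim_card[where 'a='a and 'n=4] by simp
  also have "\<dots> = vec.dim ?H + 1"
    using e by (simp add: vec.dim_insert sp H)
  finally show ?thesis by simp
qed

lemma pg_planes_eq: "pg_planes = {plane_of c0 c1 c2 c3 | c0 c1 c2 c3. (c0, c1, c2, c3) \<noteq> (0, 0, 0, 0)}"
proof (intro equalityI subsetI)
  fix H :: "('a ^ 4) set" assume "H \<in> pg_planes"
  then have H: "vec.subspace H" "vec.dim H = 3" by (auto simp: pg_planes_def)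
  have sp: "vec.span H = H" using H(1) vec.span_eq_iff by blast
  have "H \<noteq> UNIV"
  proof
    assume "H = UNIV"
    then show False using H(2) vec_dim_card[where 'a='a and 'n=4] by simp
  qed
  then obtain e where e: "e \<notin> H" by blast
  obtain B where B: "B \<subseteq> H" "vec.independent B" "H \<subseteq> vec.span B"
    using vec.basis_exists by metis
  have "vec.span B \<subseteq> H" using B(1) H(1) vec.span_minimal by blast
  then have spB: "vec.span B = H" using B(3) by blast
  have "vec.independent (insert e B)"
    using e spB B(2) vec.independent_insertI by blast
  \<comment> \<open>Only component 0 of \<open>g\<close> matters: it is a linear functional that
    vanishes on \<open>H\<close> and is 1 at \<open>e\<close>. With target \<open>'a ^ 4\<close>,
    its coefficients can be read off as row 0 of the matrix of \<open>g\<close>.\<close>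
  from vec.linear_independent_extend[OF this, of "\<lambda>x. if x = e then axis (0::4) 1 else 0"]
  obtain g :: "'a^4 \<Rightarrow> 'a^4" where g: "Vector_Spaces.linear (*s) (*s) g"
    "\<forall>x\<in>insert e B. g x = (if x = e then axis 0 1 else 0)" by blast
  have "g x = 0" if "x \<in> H" for x
  proof -
    have "x \<in> vec.span B" using that spB by simp
    moreover have "g b = 0" if "b \<in> B" for b using g(2) that e B(1) by auto
    ultimately show ?thesis
      using vec.linear_eq_0_on_span[OF g(1)] by blast
  qed
  moreover have "g e $ 0 = 1" using g(2) by (simp add: axis_def)
  moreover define c where "c = matrix g $ 0"
  have "g x $ 0 = c $ 0 * x $ 0 + c $ 1 * x $ 1 + c $ 2 * x $ 2 + c $ 3 * x $ 3" for x
  proof -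
    have "g x = matrix g *v x" using matrix_works[OF g(1)] by simp
    then show ?thesis by (simp add: matrix_vector_mult_def sum_UNIV_4 c_def)
  qed
  ultimately have sub: "H \<subseteq> plane_of (c$0) (c$1) (c$2) (c$3)" and c: "(c$0, c$1, c$2, c$3) \<noteq> (0,0,0,0)"
    by (auto simp: in_plane_of) (metis zero_index)
  have "H = plane_of (c$0) (c$1) (c$2) (c$3)"
    using vec.subspace_dim_equal[OF H(1) subspace_plane_of sub] dim_plane_of[OF c] H(2) by simp
  with c show "H \<in> {plane_of c0 c1 c2 c3 | c0 c1 c2 c3. (c0, c1, c2, c3) \<noteq> (0, 0, 0, 0)}"
    by blast
qed (auto simp: pg_planes_def subspace_plane_of intro!: dim_plane_of)

lemma plane_of_scale:
  assumes "k \<noteq> 0"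
  shows "plane_of (k * c0) (k * c1) (k * c2) (k * c3) = plane_of c0 c1 c2 c3"
proof -
  have "k * c0 * x $ 0 + k * c1 * x $ 1 + k * c2 * x $ 2 + k * c3 * x $ 3
    = k * (c0 * x $ 0 + c1 * x $ 1 + c2 * x $ 2 + c3 * x $ 3)" for x :: "'a ^ 4"
    by (simp add: algebra_simps)
  then show ?thesis using assms by (simp add: plane_of_def)
qed

section \<open>Cubic forms, points of the cubic on a plane, and chords\<close>

fun cubic_form :: "'a::field \<Rightarrow> 'a \<Rightarrow> 'a \<Rightarrow> 'a \<Rightarrow> 'a option \<Rightarrow> 'a" where
  "cubic_form c0 c1 c2 c3 (Some t) = c0 * t ^ 3 + c1 * t ^ 2 + c2 * t + c3"
| "cubic_form c0 c1 c2 c3 None = c0"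

lemma pg_point_subset_plane_iff:
  "pg_point (cubic_vec t) \<subseteq> plane_of c0 c1 c2 c3 \<longleftrightarrow> cubic_form c0 c1 c2 c3 t = 0"
proof -
  have "pg_point x \<subseteq> plane_of c0 c1 c2 c3 \<longleftrightarrow> x \<in> plane_of c0 c1 c2 c3" for x
    unfolding pg_point_def
    using subspace_plane_of vec.span_minimal[of "{x}"] vec.span_base[of x "{x}"] by blast
  then show ?thesis by (cases t) (simp_all add: in_plane_of)
qed

lemma inj_cubic_point: "inj (\<lambda>t::'a::field option. pg_point (cubic_vec t))"
proof (rule injI)
  fix s t :: "'a option"
  assume "pg_point (cubic_vec s) = pg_point (cubic_vec t)"
  then have "cubic_vec s \<in> vec.span {cubic_vec t}"
    unfolding pg_point_def using vec.span_base[of "cubic_vec s" "{cubic_vec s}"] by simp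
  then obtain k where "cubic_vec s = k *s cubic_vec t"
    by (auto simp: vec.span_singleton)
  then show "s = t"
    by (cases s; cases t) (auto simp: vec4_eq_iff)
qed

lemma cubic_points_on_plane_of:
  "cubic_points_on (plane_of c0 c1 c2 c3) =
     (\<lambda>t. pg_point (cubic_vec t)) ` {t. cubic_form c0 c1 c2 c3 t = 0}"
  unfolding cubic_points_on_def twisted_cubic_def
  using pg_point_subset_plane_iff[of _ c0 c1 c2 c3] by blast

lemma card_cubic_points_on_plane_of:
  "card (cubic_points_on (plane_of c0 c1 c2 c3)) = card {t. cubic_form c0 c1 c2 c3 t = 0}"
  unfolding cubic_points_on_plane_of
  by (rule card_image) (use inj_cubic_point inj_on_subset in blast)

text \<open>Read from \<open>x $ 3\<close> to \<open>x $ 0\<close>, the coordinates obey the linear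
  recurrence with characteristic polynomial \<open>t^2 - T * t + N\<close>. Over a field where this
  has distinct roots s and s', the solutions are the combinations of (s^3, s^2, s, 1) and (s'^3,
  s'^2, s', 1), that is, the line joining P(s) and P(s').\<close>

definition chord :: "'a::field \<Rightarrow> 'a \<Rightarrow> ('a ^ 4) set" where
  "chord T N = {x. x $ 0 - T * x $ 1 + N * x $ 2 = 0 \<and> x $ 1 - T * x $ 2 + N * x $ 3 = 0}"

lemma chord_in_pg_lines: "chord T N \<in> pg_lines"
proof -
  \<comment> \<open>\<open>u\<close> and \<open>v\<close> are the solutions of the recurrence with
    (\<open>x $ 2\<close>, \<open>x $ 3\<close>) equal to (1, 0) and (0, 1).\<close>
  define u where "u = coords (T^2 - N) T 1 0"
  define v where "v = coords (- N * T) (- N) 0 1"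
  have x_iff: "x \<in> chord T N \<longleftrightarrow> x = x $ 2 *s u + x $ 3 *s v" for x
  proof -
    have "x = x $ 2 *s u + x $ 3 *s v \<longleftrightarrow>
        x $ 0 = x $ 2 * (T^2 - N) - x $ 3 * (N * T) \<and> x $ 1 = x $ 2 * T - x $ 3 * N"
      by (auto simp: u_def v_def vec4_eq_iff algebra_simps)
    moreover have "x $ 0 - T * x $ 1 + N * x $ 2 = 0 \<and> x $ 1 - T * x $ 2 + N * x $ 3 = 0 \<longleftrightarrow>
        x $ 0 = x $ 2 * (T^2 - N) - x $ 3 * (N * T) \<and> x $ 1 = x $ 2 * T - x $ 3 * N"
      by algebra
    ultimately show ?thesis by (simp add: chord_def)
  qed
  have "vec.subspace (chord T N)"
  proof -
    have "chord T N = plane_of 1 (-T) N 0 \<inter> plane_of 0 1 (-T) N"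
      by (auto simp: chord_def in_plane_of)
    then show ?thesis by (simp add: vec.subspace_inter subspace_plane_of)
  qed
  moreover have "vec.dim (chord T N) = 2"
  proof (rule vec.dim_unique)
    show "{u, v} \<subseteq> chord T N"
      by (auto simp: chord_def u_def v_def power2_eq_square)
    show "chord T N \<subseteq> vec.span {u, v}"
    proof
      fix x assume "x \<in> chord T N"
      then have "x = x $ 2 *s u + x $ 3 *s v" by (simp add: x_iff)
      also have "\<dots> \<in> vec.span {u, v}"
        by (intro vec.span_add vec.span_scale vec.span_base) auto
      finally show "x \<in> vec.span {u, v}" .
    qed
    have "u \<noteq> v" by (auto simp: u_def v_def vec4_eq_iff)
    then show "card {u, v} = 2" by simp
    have "v \<noteq> 0" by (auto simp: v_def vec4_eq_iff)
    moreover have "u \<notin> vec.span {v}"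
      by (simp add: vec.span_singleton u_def v_def vec4_eq_iff image_iff)
    ultimately show "vec.independent {u, v}"
      by (simp add: vec.independent_insert)
  qed
  ultimately show ?thesis by (simp add: pg_lines_def)
qed

text \<open>The right-hand side compares coefficients in \<open>c0 * t^3 + c1 * t^2 + c2 * t + c3 =
  (t^2 - T * t + N) * (c0 * t + (c1 + c0 * T))\<close>, so it expresses divisibility. Two points
  spanning the chord suffice to derive it.\<close>

lemma chord_subset_plane_iff:
  "chord T N \<subseteq> plane_of c0 c1 c2 c3 \<longleftrightarrow>
     c2 = c0 * N - (c1 + c0 * T) * T \<and> c3 = (c1 + c0 * T) * N" (is "?L \<longleftrightarrow> ?R")
proof
  assume ?L
  moreover have "coords (T^2 - N) T 1 0 \<in> chord T N" "coords (- N * T) (- N) 0 1 \<in> chord T N"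
    by (auto simp: chord_def power2_eq_square)
  ultimately have "coords (T^2 - N) T 1 0 \<in> plane_of c0 c1 c2 c3"
    "coords (- N * T) (- N) 0 1 \<in> plane_of c0 c1 c2 c3" by blast+
  then have "c0 * (T^2 - N) + c1 * T + c2 = 0" "c0 * (- N * T) - c1 * N + c3 = 0"
    by (auto simp: in_plane_of)
  then show ?R by algebra
next
  assume R: ?R
  show ?L
  proof
    fix x assume "x \<in> chord T N"
    then have "x $ 0 - T * x $ 1 + N * x $ 2 = 0" "x $ 1 - T * x $ 2 + N * x $ 3 = 0"
      by (auto simp: chord_def)
    then have "c0 * x $ 0 + c1 * x $ 1 + (c0 * N - (c1 + c0 * T) * T) * x $ 2
        + (c1 + c0 * T) * N * x $ 3 = 0"
      by algebra
    then show "x \<in> plane_of c0 c1 c2 c3"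
      by (simp add: in_plane_of R)
  qed
qed

section \<open>The pencil of planes through a chord\<close>

text \<open>The cubic form of \<open>chord_plane T N (Some r)\<close> is \<open>(t - r) (t\<^sup>2 - T t + N)\<close>.\<close>

fun chord_plane :: "'a::field \<Rightarrow> 'a \<Rightarrow> 'a option \<Rightarrow> ('a ^ 4) set" where
  "chord_plane T N (Some t) = plane_of 1 (- T - t) (N + t * T) (- t * N)"
| "chord_plane T N None = plane_of 0 1 (- T) N"

text \<open>In degree 2, having no root in the field is the same as being irreducible.\<close>

definition irred :: "'a::field \<Rightarrow> 'a \<Rightarrow> bool" where
  "irred T N \<longleftrightarrow> (\<forall>t. t ^ 2 - T * t + N \<noteq> 0)"

lemma planes_through_chord: "planes_through (chord T N) = range (chord_plane T N)"
proof (intro equalityI subsetI)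
  fix H assume "H \<in> planes_through (chord T N)"
  then obtain c0 c1 c2 c3 where H: "H = plane_of c0 c1 c2 c3" and nz: "(c0, c1, c2, c3) \<noteq> (0,0,0,0)"
    and sub: "chord T N \<subseteq> H" by (auto simp: planes_through_def pg_planes_eq)
  have c: "c2 = c0 * N - (c1 + c0 * T) * T" "c3 = (c1 + c0 * T) * N"
    using sub unfolding H chord_subset_plane_iff by auto
  show "H \<in> range (chord_plane T N)"
  proof (cases "c0 = 0")
    case True
    then have "c1 \<noteq> 0" using nz c by auto
    then have "H = chord_plane T N None"
      using plane_of_scale[of c1 0 1 "-T" N] by (simp add: H c True)
    then show ?thesis by blast
  next
    case False
    \<comment> \<open>The zero of the linear cofactor \<open>c0 * t + (c1 + c0 * T)\<close>; for
      \<open>c0 = 0\<close> the cofactor is a constant and its zero is at infinity.\<close>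
    define t where "t = - (c1 + c0 * T) / c0"
    have c1: "c1 = - c0 * T - c0 * t" using False by (simp add: t_def field_simps)
    have "H = chord_plane T N (Some t)"
      using plane_of_scale[OF False, of 1 "- T - t" "N + t * T" "- t * N"]
      by (simp add: H c c1 algebra_simps)
    then show ?thesis by blast
  qed
next
  fix H assume "H \<in> range (chord_plane T N)"
  then obtain t where t: "H = chord_plane T N t" by blast
  have "plane_of c0 c1 c2 c3 \<in> pg_planes" if "c0 = 1 \<or> c1 = 1" for c0 c1 c2 c3 :: 'a
    using that by (auto simp: pg_planes_def subspace_plane_of intro!: dim_plane_of)
  then have "H \<in> pg_planes"
    unfolding t by (cases t) simp_all
  moreover have "chord T N \<subseteq> H"
    unfolding t by (cases t) (simp_all add: chord_subset_plane_iff algebra_simps)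
  ultimately show "H \<in> planes_through (chord T N)"
    by (simp add: planes_through_def)
qed

lemma cubic_points_on_chord_plane:
  assumes "irred T N"
  shows "cubic_points_on (chord_plane T N t) = {pg_point (cubic_vec t)}"
proof (cases t)
  case None
  have "cubic_form 0 1 (-T) N s = 0 \<longleftrightarrow> s = None" for s
    using assms by (cases s) (auto simp: irred_def)
  then show ?thesis by (simp add: None cubic_points_on_plane_of)
next
  case (Some r)
  have "cubic_form 1 (- T - r) (N + r * T) (- r * N) (Some x) = (x - r) * (x^2 - T * x + N)" for x
    by (simp add: algebra_simps power2_eq_square power3_eq_cube)
  then have "cubic_form 1 (- T - r) (N + r * T) (- r * N) s = 0 \<longleftrightarrow> s = Some r" for s
    using assms by (cases s) (auto simp: irred_def simp del: cubic_form.simps(1))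
  then show ?thesis by (simp add: Some cubic_points_on_plane_of)
qed

text \<open>The parameter is recovered from the only point of the cubic on the plane.\<close>

lemma inj_chord_plane: "irred T N \<Longrightarrow> inj (chord_plane T N)"
  by (rule injI) (metis cubic_points_on_chord_plane inj_cubic_point injD singleton_inject)

lemma card_planes_through_chord:
  fixes T N :: "'a::{field,finite}"
  assumes "irred T N"
  shows "card (planes_through (chord T N)) = CARD('a) + 1"
  using card_image[OF inj_chord_plane[OF assms]]
  by (simp add: planes_through_chord card_UNIV_option)

lemma chord_not_subset_osculating_plane:
  assumes "irred T N"
  shows "\<not> chord T N \<subseteq> osculating_plane t"
proof (cases t)
  case None
  then show ?thesis by (simp add: chord_subset_plane_iff)
next
  case (Some r)
  show ?thesis
  proof
    assume "chord T N \<subseteq> osculating_plane t"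
    then have "3 * r^2 = N - (T - 3 * r) * T" "- (r^3) = (T - 3 * r) * N"
      by (auto simp: Some chord_subset_plane_iff)
    then have *: "3 * r^2 - N + (T - 3 * r) * T = 0" "r^3 + (T - 3 * r) * N = 0"
      by algebra+
    \<comment> \<open>If the quadratic divides (t - r)^3, the cofactor has the zero
      \<open>3 * r - T\<close>. The left-hand side is the value of the product at \<open>r\<close>,
      where the cube vanishes.\<close>
    have "(r - (3 * r - T)) * (r^2 - T * r + N) = 0"
      using * by algebra
    then have "T = 2 * r" using assms by (auto simp: irred_def)
    moreover from this have "N = r^2" using *(1) by algebra
    ultimately have "r^2 - T * r + N = 0" by (simp add: power2_eq_square)
    then show False using assms by (auto simp: irred_def)
  qed
qed

lemma planes_through_chord_subset_one_bar:
  assumes "irred T N"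
  shows "planes_through (chord T N) \<subseteq> one_bar_planes"
proof
  fix H assume H: "H \<in> planes_through (chord T N)"
  then obtain t where "H = chord_plane T N t"
    by (auto simp: planes_through_chord)
  then have "card (cubic_points_on H) = 1"
    using assms by (simp add: cubic_points_on_chord_plane)
  with H show "H \<in> one_bar_planes"
    using chord_not_subset_osculating_plane[OF assms]
    by (auto simp: one_bar_planes_def Gamma_planes_def planes_through_def)
qed
text \<open>Splitting off the only zero of the form leaves a quadratic. Any root of it would be that
  same zero, which would make the form a cube and the plane osculating.\<close>

lemma one_bar_plane_contains_chord:
  assumes "H \<in> one_bar_planes"
  shows "\<exists>T N. irred T N \<and> chord T N \<subseteq> H"
proof -
  obtain c0 c1 c2 c3 where H: "H = plane_of c0 c1 c2 c3" and nz: "(c0, c1, c2, c3) \<noteq> (0,0,0,0)"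
    using assms by (auto simp: one_bar_planes_def pg_planes_eq)
  have not_osc: "H \<noteq> osculating_plane t" for t
    using assms by (auto simp: one_bar_planes_def Gamma_planes_def)
  have "card {t. cubic_form c0 c1 c2 c3 t = 0} = 1"
    using assms by (simp add: one_bar_planes_def H card_cubic_points_on_plane_of)
  then obtain t where "{t. cubic_form c0 c1 c2 c3 t = 0} = {t}"
    by (auto simp: card_1_singleton_iff)
  then have t: "cubic_form c0 c1 c2 c3 s = 0 \<longleftrightarrow> s = t" for s
    by blast
  show ?thesis
  proof (cases t)
    case None
    have c0: "c0 = 0" using t[of None] None by simp
    have no_root: "c1 * r^2 + c2 * r + c3 \<noteq> 0" for r
      using t[of "Some r"] None c0 by simp
    have c1: "c1 \<noteq> 0"
    proof
      assume "c1 = 0"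
      have "c2 = 0"
      \<comment> \<open>A nonconstant linear remainder would give the form a second, finite
        zero.\<close>
      proof (rule ccontr)
        assume "c2 \<noteq> 0"
        then show False using no_root[of "- c3 / c2"] \<open>c1 = 0\<close> by simp
      qed
      then have "H = osculating_plane None"
        using nz c0 \<open>c1 = 0\<close> plane_of_scale[of c3 0 0 0 1] by (simp add: H)
      then show False using not_osc by blast
    qed
    have "irred (- c2 / c1) (c3 / c1)"
      unfolding irred_def
    proof
      fix r
      have "c1 * (r^2 - - c2 / c1 * r + c3 / c1) = c1 * r^2 + c2 * r + c3"
        using c1 by (simp add: field_simps)
      then show "r^2 - - c2 / c1 * r + c3 / c1 \<noteq> 0" using no_root[of r] by auto
    qed
    moreover have "chord (- c2 / c1) (c3 / c1) \<subseteq> H"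
      using c0 c1 by (simp add: H chord_subset_plane_iff)
    ultimately show ?thesis by blast
  next
    case (Some r)
    have c0: "c0 \<noteq> 0" using t[of None] Some by simp
    have root: "c0 * x^3 + c1 * x^2 + c2 * x + c3 = 0 \<longleftrightarrow> x = r" for x
      using t[of "Some x"] Some by simp
    \<comment> \<open>\<open>T\<close> and \<open>N\<close> are read off from the quotient of the
      form by \<open>c0 * (x - r)\<close>; the remainder is zero because \<open>r\<close> is a
      root.\<close>
    define T where "T = - c1 / c0 - r"
    define N where "N = c2 / c0 - r * T"
    have c1: "c1 = - c0 * (T + r)" using c0 by (simp add: T_def)
    have c2: "c2 = c0 * (N + r * T)" using c0 by (simp add: N_def)
    have c3: "c3 = - c0 * (r * N)"
      using root[of r] unfolding c1 c2 by algebra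
    have eq: "c0 * x^3 + c1 * x^2 + c2 * x + c3 = c0 * ((x - r) * (x^2 - T * x + N))" for x
      unfolding c1 c2 c3 by algebra
    have only: "x = r" if "x^2 - T * x + N = 0" for x
      using root[of x] that unfolding eq by simp
    have "irred T N"
    proof (rule ccontr)
      assume "\<not> irred T N"
      then obtain x where "x^2 - T * x + N = 0" by (auto simp: irred_def)
      then have r: "r^2 - T * r + N = 0" using only by blast
      \<comment> \<open>By Vieta, \<open>T - r\<close> is the other root of the quadratic; it is a
        zero of the form too, hence again \<open>r\<close>.\<close>
      then have "(T - r)^2 - T * (T - r) + N = 0" by algebra
      then have "T - r = r" by (rule only)
      then have T: "T = 2 * r" by (simp add: algebra_simps)
      then have N: "N = r^2" using r by algebra
      have "H = osculating_plane (Some r)"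
        using plane_of_scale[OF c0, of 1 "- 3 * r" "3 * r^2" "- (r^3)"]
        by (simp add: H c1 c2 c3 T N power2_eq_square power3_eq_cube algebra_simps)
      then show False using not_osc by blast
    qed
    moreover have "chord T N \<subseteq> H"
      by (simp add: H c1 c2 c3 chord_subset_plane_iff algebra_simps)
    ultimately show ?thesis by blast
  qed
qed

lemma chord_unique_in_plane:
  assumes "irred T N" "irred T' N'" "H \<in> pg_planes" "chord T N \<subseteq> H" "chord T' N' \<subseteq> H"
  shows "T = T' \<and> N = N'"
proof -
  have "H \<in> range (chord_plane T N)"
    using assms planes_through_chord[of T N] by (auto simp: planes_through_def)
  then obtain t where t: "H = chord_plane T N t" by blast
  show ?thesis
  proof (cases t)
    case None
    then show ?thesis using assms(5) by (simp add: t chord_subset_plane_iff)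
  next
    case (Some r)
    have sub: "chord T' N' \<subseteq> plane_of 1 (- T - r) (N + r * T) (- r * N)"
      using assms(5) by (simp add: t Some)
    then have eqs: "N + r * T = N' - (- T - r + T') * T'" "- r * N = (- T - r + T') * N'"
      by (simp_all add: chord_subset_plane_iff)
    \<comment> \<open>The form (t - r)(t^2 - T t + N) is also divisible by t^2 - T' t + N', with
      cofactor t + (T' - T - r). Evaluation at \<open>r\<close> gives this product, and its second
      factor is nonzero by irreducibility.\<close>
    have "(T' - T) * (r^2 - T' * r + N') = 0"
      using eqs by algebra
    then have "T' = T" using assms(2) by (auto simp: irred_def)
    moreover from this have "N' = N" using eqs(1) by simp
    ultimately show ?thesis by simp
  qed
qed

subsection \<open>Quadratic extensions of finite fields\<close>


text \<open>Multiplication by a nonzero \<open>x\<close> permutes the nonzero elements, so the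
  factor it contributes to their product is 1.\<close>

lemma power_CARD_eq_same:
  fixes x :: "'a::{field,finite}"
  shows "x ^ CARD('a) = x"
proof (cases "x = 0")
  case False
  have "(\<Prod>y\<in>UNIV - {0}. y) = (\<Prod>y\<in>UNIV - {0}. x * y)"
    by (rule prod.reindex_bij_witness[of _ "\<lambda>y. x * y" "\<lambda>y. y / x"]) (use False in auto)
  also have "\<dots> = x ^ (CARD('a) - 1) * (\<Prod>y\<in>UNIV - {0}. y)"
    by (simp add: prod.distrib)
  finally have "x ^ (CARD('a) - 1) = 1" by simp
  then have "x * x ^ (CARD('a) - 1) = x" by simp
  then show ?thesis
    by (metis One_nat_def Suc_pred power_Suc zero_less_card_finite)
qed simp

section \<open>The Frobenius map and minimal polynomials over F_q\<close>

locale quadratic_extension =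
  fixes h :: "'a::{field,finite} \<Rightarrow> 'b::{field,finite}"
  assumes embedding: "field_embedding h"
    and card_extension: "CARD('b) = CARD('a) ^ 2"
begin

lemma h_1 [simp]: "h 1 = 1"
  and h_add [simp]: "h (x + y) = h x + h y"
  and h_mult [simp]: "h (x * y) = h x * h y"
  using embedding by (auto simp: field_embedding_def)

lemma h_0 [simp]: "h 0 = 0"
  by (metis add_cancel_right_right h_add)

lemma h_minus [simp]: "h (- x) = - h x"
  using h_add[of x "- x"] by (simp add: eq_neg_iff_add_eq_0 add.commute)

lemma h_diff [simp]: "h (x - y) = h x - h y"
  using h_add[of x "- y"] by simp

lemma h_power [simp]: "h (x ^ n) = h x ^ n"
  by (induction n) simp_all

lemma h_eq_0_iff [simp]: "h x = 0 \<longleftrightarrow> x = 0"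
proof
  assume "h x = 0"
  then have "h (x * inverse x) = 0" by (simp only: h_mult) simp
  then show "x = 0" by (cases "x = 0") (auto simp del: h_mult)
qed simp

lemma h_eq_iff [simp]: "h x = h y \<longleftrightarrow> x = y"
  using h_eq_0_iff[of "x - y"] by simp

lemma inj_h: "inj h"
  by (simp add: inj_def)

text \<open>The exponent is q, see \<open>frob_eq\<close>. Written as \<open>card (range h)\<close>,
  it lets \<open>'a\<close>, which is absent from the type of \<open>frob\<close>, enter through the
  parameter \<open>h\<close>.\<close>

definition frob :: "'b \<Rightarrow> 'b" where
  "frob s = s ^ card (range h)"

lemma frob_eq: "frob s = s ^ CARD('a)"
  by (simp add: frob_def card_image inj_h)

lemma frob_h [simp]: "frob (h a) = h a"
  by (metis frob_eq h_power power_CARD_eq_same)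

lemma frob_mult: "frob (x * y) = frob x * frob y"
  by (simp add: frob_def power_mult_distrib)

text \<open>
  Both sides are monic polynomials in \<open>s\<close> of degree \<open>q\<close> that vanish on \<open>F\<^sub>q\<close>. As the left-hand side
  is invariant under translation by \<open>F\<^sub>q\<close>, this gives the \<open>F\<^sub>q\<close>-linearity of the Frobenius map
  without reference to the characteristic.
\<close>
lemma prod_diff_h: "(\<Prod>a\<in>UNIV. s - h a) = frob s - s"
proof -
  define p where "p = (\<Prod>a\<in>UNIV. [:- h a, 1:])"
  define r :: "'b poly" where "r = monom 1 CARD('a) - monom 1 1"
  \<comment> \<open>With q at least 2, the term \<open>monom 1 1\<close> does not touch the leading
    coefficient of \<open>r\<close>.\<close>
  have "card {0, 1::'a} \<le> CARD('a)" by (rule card_mono) auto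
  then have q: "CARD('a) \<ge> 2" by simp
  have deg: "degree p = CARD('a)"
    unfolding p_def by (subst degree_prod_eq_sum_degree) auto
  have "lead_coeff p = 1" by (simp add: p_def lead_coeff_prod)
  have "p = r"
  \<comment> \<open>The leading terms cancel in the difference, which has degree below q but q
    zeros.\<close>
  proof (rule poly_eqI_degree_lead_coeff)
    show "coeff p CARD('a) = coeff r CARD('a)"
      using q \<open>lead_coeff p = 1\<close> deg by (simp add: r_def)
    show "card (range h) \<ge> CARD('a)" by (simp add: card_image inj_h)
    show "degree p \<le> CARD('a)" by (simp add: deg)
    show "degree r \<le> CARD('a)"
      unfolding r_def using q by (intro degree_diff_le degree_monom_le[THEN order_trans]) auto
    fix z assume "z \<in> range h"
    then show "poly p z = poly r z"
      by (auto simp: p_def r_def poly_prod poly_monom simp flip: frob_eq)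
  qed
  moreover have "poly p s = (\<Prod>a\<in>UNIV. s - h a)" by (simp add: p_def poly_prod)
  moreover have "poly r s = frob s - s" by (simp add: r_def poly_monom frob_eq)
  ultimately show ?thesis by simp
qed

lemma frob_eq_iff: "frob s = s \<longleftrightarrow> s \<in> range h"
  using prod_diff_h[of s] by auto

lemma frob_add_h: "frob (s + h a) = frob s + h a"
proof -
  have "(\<Prod>c\<in>UNIV. s + h a - h c) = (\<Prod>c\<in>UNIV. s - h c)"
    by (rule prod.reindex_bij_witness[of _ "\<lambda>c. c + a" "\<lambda>c. c - a"]) auto
  then have "frob (s + h a) - (s + h a) = frob s - s"
    by (simp only: prod_diff_h)
  then show ?thesis by (simp add: algebra_simps)
qed

lemma frob_linear: "frob (h b * s + h a) = h b * frob s + h a"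
  by (simp add: frob_add_h frob_mult)

lemma h_linear_eq_iff:
  assumes "s \<notin> range h"
  shows "h b * s + h a = h d * s + h c \<longleftrightarrow> b = d \<and> a = c"
proof
  assume eq: "h b * s + h a = h d * s + h c"
  have "b = d"
  proof (rule ccontr)
    assume "b \<noteq> d"
    have "h (b - d) * s = h (c - a)" using eq by (simp add: algebra_simps)
    then have "h (inverse (b - d) * (b - d)) * s = h (inverse (b - d) * (c - a))"
      by (simp only: h_mult mult.assoc)
    then have "s = h (inverse (b - d) * (c - a))"
      using \<open>b \<noteq> d\<close> by (simp del: h_mult)
    with assms show False by blast
  qed
  with eq show "b = d \<and> a = c" by simp
qed simp

text \<open>There are q^2 pairs of coefficients and q^2 elements of the extension, so uniqueness of
  the representation gives existence.\<close>

lemma h_linear_surj: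
  assumes "s \<notin> range h"
  shows "\<exists>b a. z = h b * s + h a"
proof -
  let ?f = "\<lambda>(b, a). h b * s + h a"
  have "inj ?f" by (auto simp: inj_def h_linear_eq_iff[OF assms])
  then have "card (range ?f) = CARD('b)"
    by (simp add: card_image card_prod card_extension power2_eq_square flip: UNIV_Times_UNIV)
  then have "range ?f = UNIV" by (intro card_subset_eq) auto
  then have "z \<in> range ?f" by blast
  then show ?thesis by auto
qed

lemma min_poly_exists:
  assumes "s \<notin> range h"
  shows "\<exists>T N. s ^ 2 - h T * s + h N = 0"
proof -
  obtain b a where "s ^ 2 = h b * s + h a" using h_linear_surj[OF assms] by blast
  then have "s ^ 2 - h b * s + h (- a) = 0" by simp
  then show ?thesis by blast
qed

text \<open>Frobenius fixes the coefficients of the quadratic, so \<open>frob s\<close> is a root as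
  well, and it differs from \<open>s\<close> outside F_q. The claims are then Vieta's
  formulas.\<close>

lemma frob_root:
  assumes "s \<notin> range h" "s ^ 2 - h T * s + h N = 0"
  shows "frob s = h T - s" "h N = s * frob s"
proof -
  have "s ^ 2 = h T * s + h (- N)" using assms by (simp add: algebra_simps)
  then have "frob (s ^ 2) = h T * frob s + h (- N)" using frob_linear by metis
  then have "frob s ^ 2 - h T * frob s + h N = 0"
    by (simp add: power2_eq_square frob_mult)
  then have "(frob s - s) * (frob s - (h T - s)) = 0" using assms(2) by algebra
  then show "frob s = h T - s" using assms(1) frob_eq_iff by auto
  then show "h N = s * frob s" using assms(2) by algebra
qed

lemma root_frob:
  assumes "s \<notin> range h" "s ^ 2 - h T * s + h N = 0"
  shows "z ^ 2 - h T * z + h N = 0 \<longleftrightarrow> z = s \<or> z = frob s"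
proof -
  have "z ^ 2 - h T * z + h N = (z - s) * (z - frob s)"
    using assms(2) unfolding frob_root(1)[OF assms] by algebra
  then show ?thesis by simp
qed

lemma frob_notin_range:
  assumes "s \<notin> range h"
  shows "frob s \<notin> range h"
proof
  assume "frob s \<in> range h"
  then obtain a where "frob s = h a" by blast
  moreover obtain T N where "s ^ 2 - h T * s + h N = 0"
    using min_poly_exists[OF assms] by blast
  ultimately have "s = h (T - a)"
    using frob_root(1)[OF assms] by (simp add: algebra_simps)
  with assms show False by blast
qed

lemma irred_min_poly:
  assumes "s \<notin> range h" "s ^ 2 - h T * s + h N = 0"
  shows "irred T N"
  unfolding irred_def
proof (intro allI notI)
  fix t assume "t ^ 2 - T * t + N = 0"
  then have "h t ^ 2 - h T * h t + h N = 0"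
    by (metis h_0 h_add h_diff h_mult h_power)
  then have "h t = s \<or> h t = frob s" using root_frob[OF assms] by blast
  then show False using assms(1) frob_notin_range by (metis rangeI)
qed

text \<open>The vectors of powers of \<open>s\<close> and of \<open>frob s\<close> both satisfy the
  recurrence defining \<open>chord T N\<close>. Conversely, a solution is determined by its last two
  coordinates, which some combination of the two vectors matches.\<close>

lemma imaginary_chord_eq:
  assumes "s \<notin> range h" "s ^ 2 - h T * s + h N = 0"
  shows "imaginary_chord h s = chord T N"
proof (intro equalityI subsetI)
  let ?u = "cubic_vec (Some s)" and ?v = "cubic_vec (Some (frob s))"
  have fs: "frob s ^ 2 - h T * frob s + h N = 0" using root_frob[OF assms] by blast
  fix x
  {
    assume "x \<in> imaginary_chord h s"
    then have "(\<chi> i. h (x $ i)) \<in> vec.span {?u, ?v}" by (simp add: imaginary_chord_def frob_eq)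
    then obtain k l where "(\<chi> i. h (x $ i)) = k *s ?u + l *s ?v"
      by (auto simp: vec.span_breakdown_eq algebra_simps)
    then have x: "h (x $ 0) = k * s ^ 3 + l * frob s ^ 3" "h (x $ 1) = k * s ^ 2 + l * frob s ^ 2"
      "h (x $ 2) = k * s + l * frob s" "h (x $ 3) = k + l"
      by (auto simp: vec4_eq_iff)
    have "h (x $ 0 - T * x $ 1 + N * x $ 2) = 0"
      unfolding h_add h_diff h_mult x using assms(2) fs by algebra
    moreover have "h (x $ 1 - T * x $ 2 + N * x $ 3) = 0"
      unfolding h_add h_diff h_mult x using assms(2) fs by algebra
    ultimately show "x \<in> chord T N" unfolding h_eq_0_iff by (simp add: chord_def)
  }
  {
    assume "x \<in> chord T N"
    then have "x $ 0 = T * x $ 1 - N * x $ 2" "x $ 1 = T * x $ 2 - N * x $ 3"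
      by (auto simp: chord_def algebra_simps)
    then have x: "h (x $ 0) = h T * h (x $ 1) - h N * h (x $ 2)"
      "h (x $ 1) = h T * h (x $ 2) - h N * h (x $ 3)"
      by (metis h_diff h_mult)+
    have ne: "s - frob s \<noteq> 0" using assms(1) frob_eq_iff[of s] by auto
    \<comment> \<open>\<open>k\<close> and \<open>l\<close> solve the system k + l = h (x $ 3), k s
      + l (frob s) = h (x $ 2), whose determinant is nonzero as s and \<open>frob s\<close>
      differ.\<close>
    define k where "k = (h (x $ 2) - frob s * h (x $ 3)) / (s - frob s)"
    define l where "l = h (x $ 3) - k"
    have x3: "h (x $ 3) = k + l" by (simp add: l_def)
    have "k * (s - frob s) = h (x $ 2) - frob s * h (x $ 3)" using ne by (simp add: k_def)
    then have x2: "h (x $ 2) = k * s + l * frob s" by (simp add: l_def algebra_simps)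
    have x1: "h (x $ 1) = k * s ^ 2 + l * frob s ^ 2"
      unfolding x(2) x2 x3 using assms(2) fs by algebra
    have x0: "h (x $ 0) = k * s ^ 3 + l * frob s ^ 3"
      unfolding x(1) x2 x1 using assms(2) fs by algebra
    have "(\<chi> i. h (x $ i)) = k *s ?u + l *s ?v"
      by (simp add: vec4_eq_iff x0 x1 x2 x3)
    also have "\<dots> \<in> vec.span {?u, ?v}"
      by (intro vec.span_add vec.span_scale vec.span_base) auto
    finally show "x \<in> imaginary_chord h s" by (simp add: imaginary_chord_def frob_eq)
  }
qed

end

section \<open>Counting irreducible quadratics\<close>

definition irreds :: "('a::field \<times> 'a) set" where
  "irreds = {(T, N). irred T N}"

text \<open>Among the q^2 monic quadratics, the reducible ones correspond to sets of one or two
  roots, so there are q + (q choose 2) of them; and q^2 = q + 2 (q choose 2).\<close>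

lemma card_irreds: "card (irreds :: ('a::{field,finite} \<times> 'a) set) = CARD('a) choose 2"
proof -
  define roots where "roots = (\<lambda>(T, N). {t::'a. t ^ 2 - T * t + N = 0})"
  have roots: "roots (T, N) = {a, T - a}" if "a \<in> roots (T, N)" for a T N
  proof -
    have "t ^ 2 - T * t + N = (t - a) * (t - (T - a))" for t
      using that unfolding roots_def by simp algebra
    then show ?thesis by (auto simp: roots_def)
  qed
  \<comment> \<open>A reducible monic quadratic is determined by its set of roots, which has one or two elements.\<close>
  have "inj_on roots (- irreds)"
  proof (rule inj_onI, clarify)
    fix T N T' N' assume "(T, N) \<notin> irreds" and eq: "roots (T, N) = roots (T', N')"
    then obtain a where a: "a \<in> roots (T, N)" by (auto simp: irreds_def irred_def roots_def)
    have "{a, T - a} = {a, T' - a}" using roots a eq by metis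
    then have "T = T'" by (auto simp: doubleton_eq_iff)
    moreover have "a ^ 2 - T * a + N = a ^ 2 - T' * a + N'"
      using a eq by (auto simp: roots_def)
    ultimately show "T = T' \<and> N = N'" by simp
  qed
  moreover have "roots ` (- irreds) = {S. card S = 1} \<union> {S. card S = 2}"
  proof (intro equalityI subsetI)
    fix S assume "S \<in> roots ` (- irreds)"
    then obtain T N a where "S = roots (T, N)" "a \<in> S"
      by (auto simp: irreds_def irred_def roots_def)
    then have "S = {a, T - a}" using roots by simp
    then show "S \<in> {S. card S = 1} \<union> {S. card S = 2}" by (cases "a = T - a") auto
  next
    fix S :: "'a set" assume "S \<in> {S. card S = 1} \<union> {S. card S = 2}"
    then obtain a b where S: "S = {a, b}" by (auto simp: card_1_singleton_iff card_2_iff)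
    \<comment> \<open>The quadratic is (t - a)(t - b), with a = b when \<open>S\<close> is a
      singleton.\<close>
    have "a \<in> roots (a + b, a * b)" by (simp add: roots_def algebra_simps power2_eq_square)
    then have "roots (a + b, a * b) = S" "(a + b, a * b) \<notin> irreds"
      using roots[of a "a + b" "a * b"] by (auto simp: S irreds_def irred_def roots_def)
    then show "S \<in> roots ` (- irreds)" by blast
  qed
  ultimately have "card (- irreds :: ('a \<times> 'a) set) = card ({S::'a set. card S = 1} \<union> {S. card S = 2})"
    using card_image by metis
  also have "\<dots> = CARD('a) + (CARD('a) choose 2)"
    using n_subsets[of "UNIV :: 'a set" 1] n_subsets[of "UNIV :: 'a set" 2]
    by (subst card_Un_disjoint) auto
  finally have "CARD('a \<times> 'a) = card (irreds :: ('a \<times> 'a) set) + (CARD('a) + (CARD('a) choose 2))"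
    using card_Un_disjoint[of "irreds :: ('a \<times> 'a) set" "- irreds"]
    by (simp add: Compl_partition)
  moreover have "CARD('a \<times> 'a) = CARD('a) + 2 * (CARD('a) choose 2)"
    by (cases "CARD('a)") (simp_all add: choose_two flip: UNIV_Times_UNIV)
  ultimately show ?thesis by simp
qed

section \<open>Imaginary chords correspond to irreducible quadratics\<close>

context quadratic_extension
begin

lemma card_Compl_range_h: "card (- range h) = 2 * (CARD('a) choose 2)"
proof -
  have "card (- range h) = CARD('a) ^ 2 - CARD('a)"
    by (simp add: Compl_eq_Diff_UNIV card_Diff_subset card_extension card_image inj_h)
  also have "\<dots> = CARD('a) * (CARD('a) - 1)" by (simp add: power2_eq_square algebra_simps)
  finally show ?thesis by (simp add: choose_two)
qed

text \<open>Let \<open>I\<close> consist of the quadratics with a root outside F_q. Their root sets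
  \<open>R p\<close> have two elements and partition the q^2 - q elements outside F_q, so
  \<open>I\<close> has (q choose 2) members. All of them are irreducible, and there are no more
  irreducible quadratics than that.\<close>

lemma irred_has_root:
  assumes "irred T N"
  shows "\<exists>s. s \<notin> range h \<and> s ^ 2 - h T * s + h N = 0"
proof -
  define R where "R p = {s. s \<notin> range h \<and> s ^ 2 - h (fst p) * s + h (snd p) = 0}" for p
  define I where "I = {p. R p \<noteq> {}}"
  have cardR: "card (R p) = 2" if "p \<in> I" for p
  proof -
    obtain s where s: "s \<notin> range h" "s ^ 2 - h (fst p) * s + h (snd p) = 0"
      using \<open>p \<in> I\<close> by (auto simp: I_def R_def)
    then have "R p = {s, frob s}"
      using root_frob[OF s] frob_notin_range[OF s(1)] by (auto simp: R_def)
    then show ?thesis using s(1) frob_eq_iff[of s] by auto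
  qed
  have disj: "R p \<inter> R p' = {}" if "p \<noteq> p'" for p p'
  proof (rule ccontr)
    assume "R p \<inter> R p' \<noteq> {}"
    then obtain s where s: "s \<notin> range h" "s ^ 2 - h (fst p) * s + h (snd p) = 0"
      "s ^ 2 - h (fst p') * s + h (snd p') = 0" by (auto simp: R_def)
    \<comment> \<open>Both sides equal \<open>s ^ 2\<close>, and coefficients with respect to
      \<open>s\<close> and 1 are unique.\<close>
    have "h (fst p) * s + h (- snd p) = h (fst p') * s + h (- snd p')"
      using s(2,3) unfolding h_minus by algebra
    then show False using that by (simp only: h_linear_eq_iff[OF s(1)]) (auto simp: prod_eq_iff)
  qed
  have "- range h = (\<Union>p\<in>I. R p)"
  proof (intro equalityI subsetI)
    fix s assume "s \<in> - range h"
    then obtain T N where "s \<in> R (T, N)"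
      using min_poly_exists[of s] unfolding R_def fst_conv snd_conv by blast
    then show "s \<in> (\<Union>p\<in>I. R p)" unfolding I_def by blast
  qed (auto simp: R_def)
  then have "card (- range h) = (\<Sum>p\<in>I. card (R p))"
    by (simp add: card_UN_disjoint disj)
  also have "\<dots> = 2 * card I" by (simp add: cardR)
  finally have card_I: "card I = card (irreds :: ('a \<times> 'a) set)"
    by (simp add: card_Compl_range_h card_irreds)
  have "I \<subseteq> irreds"
  proof
    fix p assume "p \<in> I"
    then obtain s where "s \<notin> range h" "s ^ 2 - h (fst p) * s + h (snd p) = 0"
      unfolding I_def R_def by blast
    then show "p \<in> irreds" using irred_min_poly by (simp add: irreds_def case_prod_beta)
  qed
  then have "I = irreds" by (rule card_subset_eq[OF finite _ card_I])
  moreover have "(T, N) \<in> irreds" using assms by (simp add: irreds_def)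
  ultimately have "R (T, N) \<noteq> {}" unfolding I_def by blast
  then show ?thesis unfolding R_def fst_conv snd_conv by blast
qed

text \<open>This eliminates the extension field: imaginary chords are from here on handled by pairs
  of coefficients in F_q.\<close>

lemma imaginary_chords_eq: "imaginary_chords h = (\<lambda>(T, N). chord T N) ` irreds"
proof (intro equalityI subsetI)
  fix L :: "('a ^ 4) set" assume "L \<in> imaginary_chords h"
  then obtain s where s: "s \<notin> range h" "L = imaginary_chord h s"
    by (auto simp: imaginary_chords_def)
  obtain T N where "s ^ 2 - h T * s + h N = 0" using min_poly_exists[OF s(1)] by blast
  then have "L = chord T N" "(T, N) \<in> irreds"
    using s imaginary_chord_eq irred_min_poly by (auto simp: irreds_def)
  then show "L \<in> (\<lambda>(T, N). chord T N) ` irreds" by blast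
next
  fix L :: "('a ^ 4) set" assume "L \<in> (\<lambda>(T, N). chord T N) ` irreds"
  then obtain T N where TN: "irred T N" "L = chord T N" by (auto simp: irreds_def)
  obtain s where s: "s \<notin> range h" "s ^ 2 - h T * s + h N = 0"
    using irred_has_root[OF TN(1)] by blast
  then have "L = imaginary_chord h s" using TN imaginary_chord_eq by simp
  with s(1) show "L \<in> imaginary_chords h" unfolding imaginary_chords_def by blast
qed

lemma card_imaginary_chords: "card (imaginary_chords h) = CARD('a) choose 2"
proof -
  have "inj_on (\<lambda>(T, N). chord T N) (irreds :: ('a \<times> 'a) set)"
  proof (rule inj_onI, clarify)
    fix T N T' N' :: 'a
    assume *: "(T, N) \<in> irreds" "(T', N') \<in> irreds" and eq: "chord T N = chord T' N'"
    \<comment> \<open>Equal chords share a plane, and a plane contains the chord of at most one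
      irreducible pair.\<close>
    obtain H where H: "H \<in> planes_through (chord T N)" by (auto simp: planes_through_chord)
    then show "T = T' \<and> N = N'"
      using chord_unique_in_plane[of T N T' N' H] * eq by (auto simp: planes_through_def irreds_def)
  qed
  then show ?thesis by (simp add: imaginary_chords_eq card_image card_irreds)
qed

end

section \<open>The pencils on the imaginary chords as a partition\<close>

theorem theorem5p3:
  fixes h :: "'a::{field,finite} \<Rightarrow> 'b::{field,finite}"
    and q :: nat
  assumes "CARD('a) = q"
    and "q \<ge> 5"
    and "CARD('b) = q ^ 2"
    and "field_embedding h"
  shows "(\<forall>H \<in> Gamma_planes \<union> secant_planes 0 \<union> secant_planes 2 \<union> secant_planes 3.
            \<forall>L \<in> imaginary_chords h. \<not> L \<subseteq> H)
       \<and> (\<forall>L \<in> imaginary_chords h.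
            card (planes_through L) = q + 1
          \<and> planes_through L \<subseteq> one_bar_planes
          \<and> pencil_with_axis (planes_through L) L)
       \<and> (\<forall>H \<in> one_bar_planes. \<exists>!L. L \<in> imaginary_chords h \<and> L \<subseteq> H)
       \<and> card (one_bar_planes :: ('a ^ 4) set set) = (q choose 2) * (q + 1)
       \<and> (\<exists>\<P>. partition_on one_bar_planes \<P>
            \<and> card \<P> = q choose 2
            \<and> (\<forall>S \<in> \<P>. \<exists>L \<in> imaginary_chords h. pencil_with_axis S L))"
proof -
  interpret quadratic_extension h
    by unfold_locales (use assms in auto)
  have chordE: "\<exists>T N. irred T N \<and> L = chord T N" if "L \<in> imaginary_chords h" for L
    using that by (auto simp: imaginary_chords_eq irreds_def)
  have chordI: "chord T N \<in> imaginary_chords h" if "irred T N" for T N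
    using that by (auto simp: imaginary_chords_eq irreds_def)
  have pencil: "card (planes_through L) = q + 1" "planes_through L \<subseteq> one_bar_planes"
    "pencil_with_axis (planes_through L) L" if L: "L \<in> imaginary_chords h" for L
  proof -
    obtain T N where TN: "irred T N" "L = chord T N" using chordE[OF L] by blast
    show "card (planes_through L) = q + 1"
      using card_planes_through_chord[OF TN(1)] TN(2) assms(1) by simp
    show "planes_through L \<subseteq> one_bar_planes"
      using planes_through_chord_subset_one_bar[OF TN(1)] TN(2) by simp
    show "pencil_with_axis (planes_through L) L"
      by (simp add: pencil_with_axis_def TN(2) chord_in_pg_lines)
  qed
  have avoid: "\<not> L \<subseteq> H"
    if H: "H \<in> Gamma_planes \<union> secant_planes 0 \<union> secant_planes 2 \<union> secant_planes 3"
      and L: "L \<in> imaginary_chords h" for H L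
  proof
    assume "L \<subseteq> H"
    have "H \<notin> Gamma_planes"
      using chordE[OF L] chord_not_subset_osculating_plane \<open>L \<subseteq> H\<close>
      by (auto simp: Gamma_planes_def)
    \<comment> \<open>Outside the osculating planes, \<open>H\<close> has 0, 2 or 3 points of the
      cubic, whereas planes through \<open>L\<close> have exactly one.\<close>
    with H have "H \<in> pg_planes" "card (cubic_points_on H) \<noteq> 1"
      by (auto simp: secant_planes_def)
    with \<open>L \<subseteq> H\<close> pencil(2)[OF L] show False
      by (auto simp: planes_through_def one_bar_planes_def)
  qed
  have unique: "L = L'"
    \<comment> \<open>Pencils on distinct imaginary chords are disjoint; the uniqueness of the chord
      in a plane, the count and the partition all rest on this.\<close>
    if L: "L \<in> imaginary_chords h" "L' \<in> imaginary_chords h"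
      and H: "H \<in> planes_through L" "H \<in> planes_through L'" for L L' H
  proof -
    obtain T N T' N' where *: "irred T N" "L = chord T N" "irred T' N'" "L' = chord T' N'"
      using chordE[OF L(1)] chordE[OF L(2)] by blast
    then have "T = T' \<and> N = N'"
      using H chord_unique_in_plane[of T N T' N' H] by (simp add: planes_through_def)
    then show ?thesis using * by simp
  qed
  have ex1: "\<exists>!L. L \<in> imaginary_chords h \<and> L \<subseteq> H" if "H \<in> one_bar_planes" for H
  proof -
    have "H \<in> pg_planes" using that by (simp add: one_bar_planes_def)
    then show ?thesis
      using one_bar_plane_contains_chord[OF that] chordI unique[where H=H]
      unfolding planes_through_def by blast
  qed
  have Union: "one_bar_planes = (\<Union>L \<in> imaginary_chords h. planes_through L)"
  proof (intro equalityI subsetI)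
    fix H :: "('a ^ 4) set" assume H: "H \<in> one_bar_planes"
    then obtain L where "L \<in> imaginary_chords h" "L \<subseteq> H" using ex1 by blast
    with H show "H \<in> (\<Union>L \<in> imaginary_chords h. planes_through L)"
      by (auto simp: planes_through_def one_bar_planes_def)
  qed (use pencil(2) in blast)
  have card: "card (one_bar_planes :: ('a ^ 4) set set) = (q choose 2) * (q + 1)"
  proof -
    have "card (\<Union>L \<in> imaginary_chords h. planes_through L) =
        (\<Sum>L \<in> imaginary_chords h. card (planes_through L))"
      by (rule card_UN_disjoint) (use unique in auto)
    then show ?thesis
      by (simp add: Union pencil(1) card_imaginary_chords assms(1))
  qed
  have nonempty: "planes_through L \<noteq> {}" if "L \<in> imaginary_chords h" for L
    using pencil(1)[OF that] by auto
  have "partition_on one_bar_planes (planes_through ` imaginary_chords h)"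
  proof (rule partition_onI)
    show "disjnt p p'" if "p \<in> planes_through ` imaginary_chords h"
      "p' \<in> planes_through ` imaginary_chords h" "p \<noteq> p'" for p p'
      using that unique by (auto simp: disjnt_iff)
  qed (use Union nonempty in auto)
  \<comment> \<open>Equal pencils share a plane because they are nonempty, so their axes
    agree.\<close>
  moreover have "inj_on planes_through (imaginary_chords h)"
    using unique nonempty by (metis equals0I inj_onI)
  then have "card (planes_through ` imaginary_chords h) = q choose 2"
    by (simp add: card_image card_imaginary_chords assms(1))
  ultimately have partition: "\<exists>\<P>. partition_on one_bar_planes \<P> \<and> card \<P> = q choose 2
      \<and> (\<forall>S \<in> \<P>. \<exists>L \<in> imaginary_chords h. pencil_with_axis S L)"
    using pencil(3) by (intro exI[of _ "planes_through ` imaginary_chords h"]) auto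
  show ?thesis
    by (intro conjI ballI) (rule avoid pencil ex1 card partition; assumption)+
qed

end
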